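(* Let $C_1(f_1)$ and $C_2(f_1,f_2)$ be any functionals such that $C_1(f_1)=C_2(f_1,f_2=0)=(R_2\cdot C_2)(f_1)$ for all $f_1$, where $R_2$ denotes restriction to zero in the second argument. Assume that the Legendre transform of $C_1$ with respect to its only variable and the Legendre transform of $C_2$ with respect to both variables are non-singular, and denote them by $\Gamma_1(q_1)=[T_1\cdot C_1](q_1)$ and $\Gamma_2(q_1,q_2)=[T_2\cdot C_2](q_1,q_2)$. Then $$\Gamma_1=T_1\circ R_2\circ T_2\circ \Gamma_2 ,$$ i.e. $\Gamma_1=T_1\cdot\big(R_2\cdot(T_2\cdot \Gamma_2)\big)$.
   Context: The variables $f_i$ and $q_i$ ($i=1,2$) range over normed vector spaces $F_i$ and $Q_i$ (over $\mathbb{K}=\mathbb{R}$ or $\mathbb{C}$) that are in duality via a continuous non-degenerate bilinear pairing $\langle f_i,q_i\rangle$; for pairs, $\langle (f_1,f_2),(q_1,q_2)\rangle=\langle f_1,q_1\rangle+\langle f_2,q_2\rangle$. All functionals are $\mathbb{K}$-valued and Fréchet differentiable. For a functional $C$ on $F$ (where $F=F_1$, $Q=Q_1$ for $T_1$, and $F=F_1\times F_2$, $Q=Q_1\times Q_2$ for $T_2$) the functional derivative $\frac{\delta C}{\delta f}(f)\in Q$ is the element, assumed to exist, with $DC(f)[h]=\langle h,\frac{\delta C}{\delta f}(f)\rangle$ for all $h\in F$. The Legendre transform of $C$ is the functional on $Q$ $$[T\cdot C](q)=\mathrm{extr}_f\,[\langle f,q\rangle-C(f)]=[\langle f,q\rangle-C(f)]_{f=f(q)},$$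 where $f(q)$ is the solution of $\frac{\delta C}{\delta f}(f)=q$. It is called non-singular if for every $q\in Q$ this equation has a unique solution $f(q)\in F$, and $q\mapsto f(q)$ is differentiable. The Legendre transform of a functional $\Gamma$ on $Q$ is defined in the same way with the roles of $F$ and $Q$ exchanged, $[T\cdot\Gamma](f)=[\langle f,q\rangle-\Gamma(q)]_{q=q(f)}$ where $q(f)$ is the unique solution of $\frac{\delta\Gamma}{\delta q}(q)=f$. $T_1$ is the Legendre transform for functionals of the first variable only, $T_2$ the Legendre transform for functionals of both variables jointly. For a functional $C$ of $(f_1,f_2)$, $(R_2\cdot C)(f_1):=C(f_1,0)$. *)

theory Defs
  imports "HOL-Analysis.Analysis"
begin

text \<open>The scalar field is a type \<open>'k :: real_normed_field\<close>, which up to isometric isomorphism means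
  the reals or the complex numbers (Ostrowski). The spaces are real normed spaces in
  the sense of the library, together with a compatible scalar multiplication by \<open>'k\<close>.\<close>

locale normed_space_over = vector_space scale
  for scale :: "'k::real_normed_field \<Rightarrow> 'a::real_normed_vector \<Rightarrow> 'a" +
  assumes scale_of_real: "scale (of_real r) x = r *\<^sub>R x"
    and norm_scale: "norm (scale c x) = norm c * norm x"

locale dual_pairing =
  F: normed_space_over scaleF + Q: normed_space_over scaleQ + bounded_bilinear pair
  for scaleF :: "'k::real_normed_field \<Rightarrow> 'f::real_normed_vector \<Rightarrow> 'f"
    and scaleQ :: "'k \<Rightarrow> 'q::real_normed_vector \<Rightarrow> 'q"
    and pair :: "'f \<Rightarrow> 'q \<Rightarrow> 'k" +
  assumes pair_scale_left: "pair (scaleF c f) q = c * pair f q"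
    and pair_scale_right: "pair f (scaleQ c q) = c * pair f q"
    and nondegenerate_left: "(\<And>q. pair f q = 0) \<Longrightarrow> f = 0"
    and nondegenerate_right: "(\<And>f. pair f q = 0) \<Longrightarrow> q = 0"

definition scale_prod :: "('k \<Rightarrow> 'a \<Rightarrow> 'a) \<Rightarrow> ('k \<Rightarrow> 'b \<Rightarrow> 'b) \<Rightarrow> 'k \<Rightarrow> 'a \<times> 'b \<Rightarrow> 'a \<times> 'b" where
  "scale_prod s1 s2 c x = (s1 c (fst x), s2 c (snd x))"

definition pair_prod ::
  "('f1 \<Rightarrow> 'q1 \<Rightarrow> 'k::plus) \<Rightarrow> ('f2 \<Rightarrow> 'q2 \<Rightarrow> 'k) \<Rightarrow> 'f1 \<times> 'f2 \<Rightarrow> 'q1 \<times> 'q2 \<Rightarrow> 'k" where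
  "pair_prod p1 p2 f q = p1 (fst f) (fst q) + p2 (snd f) (snd q)"

text \<open>Differentiability over \<open>'k\<close>. The library's \<open>has_derivative\<close> only makes the derivative
  real-linear, so linearity over \<open>'k\<close> is required in addition.\<close>

definition frechet_differentiable ::
  "('k::real_normed_field \<Rightarrow> 'a::real_normed_vector \<Rightarrow> 'a) \<Rightarrow>
   ('k \<Rightarrow> 'b::real_normed_vector \<Rightarrow> 'b) \<Rightarrow> ('a \<Rightarrow> 'b) \<Rightarrow> bool" where
  "frechet_differentiable sA sB g \<longleftrightarrow>
     (\<forall>x. \<exists>D. (g has_derivative D) (at x) \<and> Vector_Spaces.linear sA sB D)"

text \<open>\<open>has_functional_derivative pair C f q\<close> reads \<open>\<delta>C/\<delta>f(f) = q\<close>. In a dual pairing such a \<open>q\<close>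
  is unique by non-degeneracy, and the derivative \<open>\<lambda>h. pair h q\<close> is automatically linear over \<open>'k\<close>.\<close>

definition has_functional_derivative ::
  "('f::real_normed_vector \<Rightarrow> 'q \<Rightarrow> 'k::real_normed_field) \<Rightarrow> ('f \<Rightarrow> 'k) \<Rightarrow> 'f \<Rightarrow> 'q \<Rightarrow> bool" where
  "has_functional_derivative pair C f q \<longleftrightarrow> (C has_derivative (\<lambda>h. pair h q)) (at f)"

definition stationary_point ::
  "('f::real_normed_vector \<Rightarrow> 'q \<Rightarrow> 'k::real_normed_field) \<Rightarrow> ('f \<Rightarrow> 'k) \<Rightarrow> 'q \<Rightarrow> 'f" where
  "stationary_point pair C q = (THE f. has_functional_derivative pair C f q)"

text \<open>For a functional \<open>\<Gamma>\<close> on \<open>Q\<close> the Legendre transform is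
  \<open>legendre (\<lambda>q f. pair f q) \<Gamma>\<close>, a functional on \<open>F\<close>.\<close>

definition legendre ::
  "('f::real_normed_vector \<Rightarrow> 'q \<Rightarrow> 'k::real_normed_field) \<Rightarrow> ('f \<Rightarrow> 'k) \<Rightarrow> 'q \<Rightarrow> 'k" where
  "legendre pair C q = pair (stationary_point pair C q) q - C (stationary_point pair C q)"

text \<open>The condition under which \<open>legendre pair C\<close> is meaningful, the total function
  \<open>legendre\<close> being unspecified otherwise.\<close>

definition legendre_defined ::
  "('f::real_normed_vector \<Rightarrow> 'q \<Rightarrow> 'k::real_normed_field) \<Rightarrow> ('f \<Rightarrow> 'k) \<Rightarrow> bool" where
  "legendre_defined pair C \<longleftrightarrow>
     (\<forall>f. \<exists>q. has_functional_derivative pair C f q) \<and>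
     (\<forall>q. \<exists>!f. has_functional_derivative pair C f q)"

definition legendre_nonsingular ::
  "('k::real_normed_field \<Rightarrow> 'f::real_normed_vector \<Rightarrow> 'f) \<Rightarrow>
   ('k \<Rightarrow> 'q::real_normed_vector \<Rightarrow> 'q) \<Rightarrow> ('f \<Rightarrow> 'q \<Rightarrow> 'k) \<Rightarrow> ('f \<Rightarrow> 'k) \<Rightarrow> bool" where
  "legendre_nonsingular sF sQ pair C \<longleftrightarrow>
     legendre_defined pair C \<and> frechet_differentiable sQ sF (stationary_point pair C)"

definition restrict_snd_zero :: "('f1 \<times> 'f2::zero \<Rightarrow> 'k) \<Rightarrow> 'f1 \<Rightarrow> 'k" where
  "restrict_snd_zero C f1 = C (f1, 0)"

end

theory Submission
  imports Defs
begin

text \<open>For a non-singular \<open>C\<close> the derivative of \<open>q \<mapsto> \<langle>f(q), q\<rangle> - C(f(q))\<close> at \<open>q\<close> is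
  \<open>k \<mapsto> \<langle>f(q), k\<rangle>\<close>, because the two terms containing \<open>Df(q)[k]\<close> cancel by stationarity.
  Hence \<open>\<delta>(TC)/\<delta>q = f(q)\<close>, the map \<open>q \<mapsto> f(q)\<close> is a bijection inverted by \<open>\<delta>C/\<delta>f\<close>, and
  \<open>T\<close> is an involution. So \<open>T\<^sub>2 \<Gamma>\<^sub>2 = C\<^sub>2\<close>, whose restriction is \<open>C\<^sub>1\<close>.\<close>

lemma normed_space_over_scale_prod:
  assumes "normed_space_over s1" and "normed_space_over s2"
  shows "normed_space_over (scale_prod s1 s2)"
proof -
  interpret S1: normed_space_over s1 by fact
  interpret S2: normed_space_over s2 by fact
  show ?thesis
  proof
    \<comment> \<open>The product norm is Euclidean, so the square of \<open>norm c\<close> factors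
      out of the sum under the root.\<close>
    show "norm (scale_prod s1 s2 c x) = norm c * norm x" for c x
      by (simp add: scale_prod_def norm_prod_def S1.norm_scale S2.norm_scale power_mult_distrib
          real_sqrt_mult flip: distrib_left)
  qed (simp_all add: scale_prod_def prod_eq_iff S1.scale_right_distrib S2.scale_right_distrib
      S1.scale_left_distrib S2.scale_left_distrib S1.scale_of_real S2.scale_of_real)
qed

lemma norm_fst_le_norm: "norm (fst x) \<le> norm x"
  by (metis norm_fst_le prod.collapse)

lemma norm_snd_le_norm: "norm (snd x) \<le> norm x"
  by (metis norm_snd_le prod.collapse)

lemma bounded_bilinear_pair_prod:
  assumes "bounded_bilinear p1" and "bounded_bilinear p2"
  shows "bounded_bilinear (pair_prod p1 p2)"
proof -
  interpret P1: bounded_bilinear p1 by fact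
  interpret P2: bounded_bilinear p2 by fact
  \<comment> \<open>Nonnegative constants are chosen so that replacing norms of components by norms
    of pairs can only enlarge the bound.\<close>
  obtain K1 where K1: "0 \<le> K1" "\<And>a b. norm (p1 a b) \<le> norm a * norm b * K1"
    using P1.nonneg_bounded by blast
  obtain K2 where K2: "0 \<le> K2" "\<And>a b. norm (p2 a b) \<le> norm a * norm b * K2"
    using P2.nonneg_bounded by blast
  have bound: "norm (pair_prod p1 p2 f q) \<le> norm f * norm q * (K1 + K2)" for f q
  proof -
    have "norm (p1 (fst f) (fst q)) \<le> norm f * norm q * K1"
      by (rule order.trans[OF K1(2)])
        (intro mult_mono order.refl, simp_all add: K1(1) norm_fst_le_norm)
    moreover have "norm (p2 (snd f) (snd q)) \<le> norm f * norm q * K2"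
      by (rule order.trans[OF K2(2)])
        (intro mult_mono order.refl, simp_all add: K2(1) norm_snd_le_norm)
    ultimately show ?thesis
      unfolding pair_prod_def distrib_left by (intro norm_triangle_le add_mono)
  qed
  show ?thesis
  proof
    show "\<exists>K. \<forall>f q. norm (pair_prod p1 p2 f q) \<le> norm f * norm q * K"
      using bound by blast
  qed (simp_all add: pair_prod_def P1.add_left P2.add_left P1.add_right P2.add_right
      P1.scaleR_left P2.scaleR_left P1.scaleR_right P2.scaleR_right scaleR_add_right)
qed

text \<open>This makes the joint transform in two variables a transform for a single pairing, so the
  one-pairing theory below covers it as well.\<close>

lemma dual_pairing_prod:
  assumes "dual_pairing sF1 sQ1 p1" and "dual_pairing sF2 sQ2 p2"
  shows "dual_pairing (scale_prod sF1 sF2) (scale_prod sQ1 sQ2) (pair_prod p1 p2)"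
proof -
  interpret D1: dual_pairing sF1 sQ1 p1 by fact
  interpret D2: dual_pairing sF2 sQ2 p2 by fact
  show ?thesis
  proof (intro dual_pairing.intro dual_pairing_axioms.intro)
    show "normed_space_over (scale_prod sF1 sF2)" "normed_space_over (scale_prod sQ1 sQ2)"
      by (intro normed_space_over_scale_prod; unfold_locales)+
    show "bounded_bilinear (pair_prod p1 p2)"
      by (intro bounded_bilinear_pair_prod; unfold_locales)
    show "f = 0" if "\<And>q. pair_prod p1 p2 f q = 0" for f
    proof -
      have "p1 (fst f) q = 0" "p2 (snd f) q' = 0" for q q'
        \<comment> \<open>Test pairs with one zero entry isolate the two summands of
          \<open>pair_prod\<close>.\<close>
        using that[of "(q, 0)"] that[of "(0, q')"]
        by (simp_all add: pair_prod_def D1.zero_right D2.zero_right)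
      then show ?thesis
        by (simp add: prod_eq_iff D1.nondegenerate_left D2.nondegenerate_left)
    qed
    show "q = 0" if "\<And>f. pair_prod p1 p2 f q = 0" for q
    proof -
      have "p1 f (fst q) = 0" "p2 f' (snd q) = 0" for f f'
        using that[of "(f, 0)"] that[of "(0, f')"]
        by (simp_all add: pair_prod_def D1.zero_left D2.zero_left)
      then show ?thesis
        by (simp add: prod_eq_iff D1.nondegenerate_right D2.nondegenerate_right)
    qed
  qed (simp_all add: pair_prod_def scale_prod_def distrib_left D1.pair_scale_left
      D2.pair_scale_left D1.pair_scale_right D2.pair_scale_right)
qed

context dual_pairing
begin

lemma functional_derivative_unique:
  assumes "has_functional_derivative pair C f q" and "has_functional_derivative pair C f q'"
  shows "q = q'"
proof -
  have "(\<lambda>h. pair h q) = (\<lambda>h. pair h q')"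
    using assms unfolding has_functional_derivative_def by (rule has_derivative_unique)
  then have "pair h (q - q') = 0" for h
    by (simp add: diff_right fun_eq_iff)
  then show ?thesis
    using nondegenerate_right[of "q - q'"] by simp
qed

text \<open>Here the gradient lies in the first argument of \<open>pair\<close>, so non-degeneracy
  on the other side is what separates candidates.\<close>

lemma flipped_functional_derivative_unique:
  assumes "has_functional_derivative (\<lambda>q f. pair f q) G q f"
    and "has_functional_derivative (\<lambda>q f. pair f q) G q f'"
  shows "f = f'"
proof -
  have "pair f = pair f'"
    using assms unfolding has_functional_derivative_def by (rule has_derivative_unique)
  then have "pair (f - f') q = 0" for q
    by (simp add: diff_left)
  then show ?thesis
    using nondegenerate_left[of "f - f'"] by simp
qed

lemma stationary_point_eq_iff:
  assumes "legendre_defined pair C"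
  shows "stationary_point pair C q = f \<longleftrightarrow> has_functional_derivative pair C f q"
proof -
  have ex1: "\<exists>!f. has_functional_derivative pair C f q"
    using assms by (simp add: legendre_defined_def)
  show ?thesis
    using theI'[OF ex1] ex1 unfolding stationary_point_def by auto
qed

lemma legendre_has_functional_derivative:
  assumes "legendre_nonsingular scaleF scaleQ pair C"
  shows "has_functional_derivative (\<lambda>q f. pair f q) (legendre pair C) q (stationary_point pair C q)"
proof -
  let ?f = "stationary_point pair C"
  have defd: "legendre_defined pair C"
    using assms by (simp add: legendre_nonsingular_def)
  obtain D where D: "(?f has_derivative D) (at q)"
    using assms by (auto simp: legendre_nonsingular_def frechet_differentiable_def)
  have "(C has_derivative (\<lambda>h. pair h q)) (at (?f q))"
    using stationary_point_eq_iff[OF defd] by (auto simp: has_functional_derivative_def)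
  from has_derivative_compose[OF D this]
  have "((\<lambda>q. C (?f q)) has_derivative (\<lambda>k. pair (D k) q)) (at q)" .
  \<comment> \<open>\<open>FDERIV\<close> is the product rule for \<open>pair\<close>, applied to
    \<open>?f\<close> and the identity. It yields \<open>pair (?f q) k + pair (D k) q\<close>, whose
    second summand is the chain-rule term just obtained.\<close>
  from has_derivative_diff[OF FDERIV[OF D has_derivative_ident] this]
  show ?thesis
    by (simp add: has_functional_derivative_def legendre_def[abs_def])
qed

text \<open>The graphs of the two gradients are transposes of each other: one direction is the
  preceding lemma, the other holds because the transform has only one gradient at
  \<open>q\<close>.\<close>

lemma legendre_functional_derivative_iff:
  assumes "legendre_nonsingular scaleF scaleQ pair C"
  shows "has_functional_derivative (\<lambda>q f. pair f q) (legendre pair C) q f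
    \<longleftrightarrow> has_functional_derivative pair C f q"
proof -
  have "legendre_defined pair C"
    using assms by (simp add: legendre_nonsingular_def)
  from stationary_point_eq_iff[OF this, of q f] show ?thesis
    using legendre_has_functional_derivative[OF assms, of q]
      flipped_functional_derivative_unique[of "legendre pair C" q f] by blast
qed

text \<open>Transposing the graph swaps the two requirements: solvability for every \<open>q\<close>
  gives the transform a gradient everywhere, and the gradient of \<open>C\<close> at
  \<open>f\<close>, unique by non-degeneracy, is the unique stationary point for
  \<open>f\<close>.\<close>

lemma legendre_defined_legendre:
  assumes "legendre_nonsingular scaleF scaleQ pair C"
  shows "legendre_defined (\<lambda>q f. pair f q) (legendre pair C)"
proof -
  have "legendre_defined pair C"
    using assms by (simp add: legendre_nonsingular_def)
  then show ?thesis
    unfolding legendre_defined_def legendre_functional_derivative_iff[OF assms]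
    using functional_derivative_unique by blast
qed

lemma legendre_legendre:
  assumes "legendre_nonsingular scaleF scaleQ pair C"
  shows "legendre (\<lambda>q f. pair f q) (legendre pair C) = C"
proof
  fix f
  have defd: "legendre_defined pair C"
    using assms by (simp add: legendre_nonsingular_def)
  then obtain q where q: "has_functional_derivative pair C f q"
    unfolding legendre_defined_def by blast
  have "stationary_point (\<lambda>q f. pair f q) (legendre pair C) f = q"
    unfolding stationary_point_def[of "\<lambda>q f. pair f q"] legendre_functional_derivative_iff[OF assms]
    using q functional_derivative_unique by blast
  moreover have "stationary_point pair C q = f"
    using stationary_point_eq_iff[OF defd] q by blast
  \<comment> \<open>Both transforms are evaluated at the same couple \<open>f\<close>,
    \<open>q\<close>, so the value is \<open>pair f q - (pair f q - C f)\<close>.\<close>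
  ultimately show "legendre (\<lambda>q f. pair f q) (legendre pair C) f = C f"
    by (simp add: legendre_def)
qed

end

text \<open>The two \<open>legendre_defined\<close> conjuncts ensure that both transforms on the
  right-hand side are taken at existing, unique stationary points, so the equation does not rest on
  unspecified values.\<close>

theorem lemmaA1:
  fixes sF1 :: "'k::real_normed_field \<Rightarrow> 'f1::real_normed_vector \<Rightarrow> 'f1"
    and sQ1 :: "'k \<Rightarrow> 'q1::real_normed_vector \<Rightarrow> 'q1"
    and sF2 :: "'k \<Rightarrow> 'f2::real_normed_vector \<Rightarrow> 'f2"
    and sQ2 :: "'k \<Rightarrow> 'q2::real_normed_vector \<Rightarrow> 'q2"
    and p1 :: "'f1 \<Rightarrow> 'q1 \<Rightarrow> 'k"
    and p2 :: "'f2 \<Rightarrow> 'q2 \<Rightarrow> 'k"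
    and C1 :: "'f1 \<Rightarrow> 'k"
    and C2 :: "'f1 \<times> 'f2 \<Rightarrow> 'k"
    and \<Gamma>1 :: "'q1 \<Rightarrow> 'k"
    and \<Gamma>2 :: "'q1 \<times> 'q2 \<Rightarrow> 'k"
  assumes "dual_pairing sF1 sQ1 p1"
    and "dual_pairing sF2 sQ2 p2"
    and "\<And>f1. C1 f1 = restrict_snd_zero C2 f1"
    and "legendre_nonsingular sF1 sQ1 p1 C1"
    and "legendre_nonsingular (scale_prod sF1 sF2) (scale_prod sQ1 sQ2) (pair_prod p1 p2) C2"
    and "\<Gamma>1 = legendre p1 C1"
    and "\<Gamma>2 = legendre (pair_prod p1 p2) C2"
  shows "legendre_defined (\<lambda>q f. pair_prod p1 p2 f q) \<Gamma>2 \<and>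
    legendre_defined p1 (restrict_snd_zero (legendre (\<lambda>q f. pair_prod p1 p2 f q) \<Gamma>2)) \<and>
    \<Gamma>1 = legendre p1 (restrict_snd_zero (legendre (\<lambda>q f. pair_prod p1 p2 f q) \<Gamma>2))"
proof -
  interpret D: dual_pairing "scale_prod sF1 sF2" "scale_prod sQ1 sQ2" "pair_prod p1 p2"
    using assms(1,2) by (rule dual_pairing_prod)
  have "restrict_snd_zero (legendre (\<lambda>q f. pair_prod p1 p2 f q) \<Gamma>2) = C1"
    unfolding assms(7) D.legendre_legendre[OF assms(5)] using assms(3) by (simp add: fun_eq_iff)
  moreover have "legendre_defined p1 C1"
    using assms(4) by (simp add: legendre_nonsingular_def)
  ultimately show ?thesis
    using D.legendre_defined_legendre[OF assms(5)] by (simp add: assms(6,7))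
qed

end
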